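(* Let $n\ge 3$, let $a,b,c\in\mathbb{R}$ with $a+b+c\neq 0$, and let \[p=a\,\tilde e_1^{\,3}+b\,\tilde e_1\tilde e_2+c\,\tilde e_3\in\mathbb{R}[x_1,\dots,x_n].\] Then $p$ is hyperbolic with respect to $\vec 1$ if and only if $(a+b+c)\left(27ac^2-b^3-9b^2c\right)\le 0$.
   Context: $\vec 1=(1,\dots,1)\in\mathbb{R}^n$. $\tilde e_k=\binom{n}{k}^{-1}e_k$, where $e_k$ is the $k$-th elementary symmetric polynomial in $x_1,\dots,x_n$. A homogeneous $p$ is hyperbolic with respect to $v\in\mathbb{R}^n$ if $p(v)\ne0$ and for every $x\in\mathbb{R}^n$ the univariate polynomial $p(x+tv)$ in $t$ has only real roots. *)

theory Defs
  imports
    "HOL-Analysis.Analysis"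
    "HOL-Computational_Algebra.Polynomial"
    "HOL-Library.Poly_Mapping"
begin

(* The polynomial ring over the reals in variables indexed by 'n: finitely supported
   maps from exponent vectors to coefficients; "*" is the convolution product of
   Poly_Mapping. *)
type_synonym 'n real_mpoly = "('n \<Rightarrow>\<^sub>0 nat) \<Rightarrow>\<^sub>0 real"

definition Const :: "real \<Rightarrow> 'n real_mpoly" where
  "Const c = Poly_Mapping.single 0 c"

definition Var :: "'n \<Rightarrow> 'n real_mpoly" where
  "Var i = Poly_Mapping.single (Poly_Mapping.single i 1) 1"

definition elem_sym :: "nat \<Rightarrow> ('n::finite) real_mpoly" where
  "elem_sym k = (\<Sum>S\<in>{S::'n set. card S = k}. \<Prod>i\<in>S. Var i)"

definition norm_elem_sym :: "nat \<Rightarrow> ('n::finite) real_mpoly" where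
  "norm_elem_sym k = Const (inverse (real (CARD('n) choose k))) * elem_sym k"

definition homogeneous_mpoly :: "('n::finite) real_mpoly \<Rightarrow> bool" where
  "homogeneous_mpoly p \<longleftrightarrow>
     (\<exists>d. \<forall>m\<in>Poly_Mapping.keys p. (\<Sum>i\<in>UNIV. Poly_Mapping.lookup m i) = d)"

(* Substitute f i for the variable i, mapping coefficients by h. *)
definition subst_mpoly ::
    "(real \<Rightarrow> 'b::comm_semiring_1) \<Rightarrow> ('n::finite \<Rightarrow> 'b) \<Rightarrow> 'n real_mpoly \<Rightarrow> 'b" where
  "subst_mpoly h f p =
     (\<Sum>m\<in>Poly_Mapping.keys p.
        h (Poly_Mapping.lookup p m) * (\<Prod>i\<in>UNIV. f i ^ Poly_Mapping.lookup m i))"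

definition eval_mpoly :: "('n::finite) real_mpoly \<Rightarrow> real ^ 'n \<Rightarrow> real" where
  "eval_mpoly p x = subst_mpoly (\<lambda>c. c) (\<lambda>i. x $ i) p"

(* The univariate polynomial p(x + t v) in t. *)
definition restrict_line :: "('n::finite) real_mpoly \<Rightarrow> real ^ 'n \<Rightarrow> real ^ 'n \<Rightarrow> real poly" where
  "restrict_line p x v = subst_mpoly (\<lambda>c. [:c:]) (\<lambda>i. [:x $ i, v $ i:]) p"

definition only_real_roots :: "real poly \<Rightarrow> bool" where
  "only_real_roots q \<longleftrightarrow> (\<forall>z::complex. poly (map_poly complex_of_real q) z = 0 \<longrightarrow> z \<in> \<real>)"

definition hyperbolic :: "('n::finite) real_mpoly \<Rightarrow> real ^ 'n \<Rightarrow> bool" where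
  "hyperbolic p v \<longleftrightarrow>
     homogeneous_mpoly p \<and> eval_mpoly p v \<noteq> 0 \<and> (\<forall>x. only_real_roots (restrict_line p x v))"

end

theory Submission
  imports Defs
begin

text \<open>
  Writing a point of a line in direction \<open>1\<close> as \<open>y + w 1\<close> with \<open>y\<close> of mean zero turns \<open>p\<close> into the
  depressed cubic \<open>(a + b + c) w^3 - (b + 3c) u w + c v\<close>, where \<open>-u\<close> and \<open>v\<close> are the values of the
  normalized second and third elementary symmetric polynomials at \<open>y\<close>. Its discriminant is
  nonnegative for all \<open>y\<close> iff it is so for the largest possible ratio of \<open>v^2\<close> to \<open>u^3\<close>. That
  ratio is 4, attained at \<open>y = (n - 1, -1, \<dots>, -1)\<close>: in terms of power sums the bound
  \<open>v^2 \<le> 4 u^3\<close> follows by summing \<open>(y_i - (n - 1) r) (y_i + r)^2 \<le> 0\<close> with \<open>r = sqrt u\<close>.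
\<close>

section \<open>Substitution into polynomials\<close>

text \<open>If \<open>h\<close> respects 0, 1, sums and products, \<open>subst_mpoly h f\<close>
  does so too. Used below with \<open>complex_of_real\<close>, this computes p(x + z v) at complex z
  from values of elementary symmetric polynomials.\<close>

locale coeff_hom =
  fixes h :: "real \<Rightarrow> 'b::comm_semiring_1"
  assumes hom_0: "h 0 = 0" and hom_1: "h 1 = 1"
    and hom_add: "h (s + t) = h s + h t"
    and hom_mult: "h (s * t) = h s * h t"
begin

lemma subst_mpoly_add: "subst_mpoly h f (p + q) = subst_mpoly h f p + subst_mpoly h f q"
  unfolding subst_mpoly_def
  by (rule setsum_keys_plus_distrib) (simp_all add: hom_0 hom_add algebra_simps)

lemma subst_mpoly_0 [simp]: "subst_mpoly h f 0 = 0"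
  by (simp add: subst_mpoly_def)

lemma subst_mpoly_single:
  "subst_mpoly h f (Poly_Mapping.single m s) = h s * (\<Prod>i\<in>UNIV. f i ^ Poly_Mapping.lookup m i)"
  by (cases "s = 0") (simp_all add: subst_mpoly_def hom_0)

lemma subst_mpoly_single_mult:
  "subst_mpoly h f (Poly_Mapping.single m s * q) =
     subst_mpoly h f (Poly_Mapping.single m s) * subst_mpoly h f q"
proof (induction q rule: update_induct)
  case const
  then show ?case by simp
next
  case (update q k t)
  \<comment> \<open>The induction supplies a key \<open>k\<close> outside \<open>q\<close>, so
    updating adds one new monomial and additivity applies.\<close>
  have eq: "Poly_Mapping.update k t q = Poly_Mapping.single k t + q"
    using update by (intro poly_mapping_eqI)
      (auto simp: lookup_update lookup_add lookup_single in_keys_iff when_def)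
  show ?case
    unfolding eq distrib_left subst_mpoly_add update.IH mult_single subst_mpoly_single
    by (simp add: hom_mult lookup_add power_add prod.distrib algebra_simps)
qed

lemma subst_mpoly_mult: "subst_mpoly h f (p * q) = subst_mpoly h f p * subst_mpoly h f q"
proof (induction p rule: update_induct)
  case const
  then show ?case by simp
next
  case (update p k t)
  have eq: "Poly_Mapping.update k t p = Poly_Mapping.single k t + p"
    using update by (intro poly_mapping_eqI)
      (auto simp: lookup_update lookup_add lookup_single in_keys_iff when_def)
  show ?case
    unfolding eq distrib_right subst_mpoly_add update.IH subst_mpoly_single_mult ..
qed

lemma subst_mpoly_Const [simp]: "subst_mpoly h f (Const s) = h s"
  by (simp add: Const_def subst_mpoly_single)

lemma subst_mpoly_Var [simp]: "subst_mpoly h f (Var i) = f i"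
  by (simp add: Var_def subst_mpoly_single hom_1 lookup_single when_def if_distrib cong: if_cong)

lemma subst_mpoly_1 [simp]: "subst_mpoly h f 1 = 1"
  using subst_mpoly_Const[of f 1] by (simp add: Const_def hom_1)

lemma subst_mpoly_sum: "subst_mpoly h f (sum g A) = (\<Sum>x\<in>A. subst_mpoly h f (g x))"
  by (induction A rule: infinite_finite_induct) (simp_all add: subst_mpoly_add)

lemma subst_mpoly_prod: "subst_mpoly h f (prod g A) = (\<Prod>x\<in>A. subst_mpoly h f (g x))"
  by (induction A rule: infinite_finite_induct) (simp_all add: subst_mpoly_mult)

lemma subst_mpoly_power: "subst_mpoly h f (p ^ k) = subst_mpoly h f p ^ k"
  by (induction k) (simp_all add: subst_mpoly_mult)

lemma subst_mpoly_elem_sym: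
  "subst_mpoly h f (elem_sym k) = (\<Sum>S\<in>{S. card S = k}. \<Prod>i\<in>S. f i)"
  by (simp add: elem_sym_def subst_mpoly_sum subst_mpoly_prod)

end

section \<open>Complex values of real univariate polynomials and of restrictions to lines\<close>

lemma poly_map_poly_of_real_add:
  "poly (map_poly complex_of_real (p + q)) z =
     poly (map_poly complex_of_real p) z + poly (map_poly complex_of_real q) z"
  by (subst poly_add [symmetric], rule arg_cong[where f = "\<lambda>p. poly p z"], rule poly_eqI)
    (simp add: coeff_map_poly)

lemma poly_map_poly_of_real_smult:
  "poly (map_poly complex_of_real (smult s p)) z =
     complex_of_real s * poly (map_poly complex_of_real p) z"
  by (simp add: map_poly_smult)

lemma poly_map_poly_of_real_mult:
  "poly (map_poly complex_of_real (p * q)) z =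
     poly (map_poly complex_of_real p) z * poly (map_poly complex_of_real q) z"
  by (induction p)
    (simp_all add: poly_map_poly_of_real_add poly_map_poly_of_real_smult map_poly_pCons algebra_simps)

lemma poly_map_poly_of_real_sum:
  "poly (map_poly complex_of_real (sum g A)) z = (\<Sum>x\<in>A. poly (map_poly complex_of_real (g x)) z)"
  by (induction A rule: infinite_finite_induct) (simp_all add: poly_map_poly_of_real_add)

lemma poly_map_poly_of_real_prod:
  "poly (map_poly complex_of_real (prod g A)) z = (\<Prod>x\<in>A. poly (map_poly complex_of_real (g x)) z)"
  by (induction A rule: infinite_finite_induct) (simp_all add: poly_map_poly_of_real_mult)

lemma poly_map_poly_of_real_power:
  "poly (map_poly complex_of_real (p ^ k)) z = poly (map_poly complex_of_real p) z ^ k"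
  by (induction k) (simp_all add: poly_map_poly_of_real_mult)

text \<open>Turns real-rootedness along a line into a statement about substituting complex numbers
  into p, so the coefficients in t never have to be computed.\<close>

lemma poly_restrict_line:
  "poly (map_poly complex_of_real (restrict_line p x v)) z =
     subst_mpoly complex_of_real (\<lambda>i. complex_of_real (x $ i) + z * complex_of_real (v $ i)) p"
  by (simp add: restrict_line_def subst_mpoly_def poly_map_poly_of_real_sum
      poly_map_poly_of_real_mult poly_map_poly_of_real_prod poly_map_poly_of_real_power
      poly_map_poly_of_real_smult map_poly_pCons)

section \<open>Homogeneity\<close>

text \<open>Exposes the degree that \<open>homogeneous_mpoly\<close> hides under an existential, so
  that degrees can be compared in sums and added in products.\<close>

definition homogeneous_degree :: "nat \<Rightarrow> ('n::finite) real_mpoly \<Rightarrow> bool" where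
  "homogeneous_degree d p \<longleftrightarrow>
     (\<forall>m\<in>Poly_Mapping.keys p. (\<Sum>i\<in>UNIV. Poly_Mapping.lookup m i) = d)"

lemma homogeneous_degree_add:
  "homogeneous_degree d p \<Longrightarrow> homogeneous_degree d q \<Longrightarrow> homogeneous_degree d (p + q)"
  unfolding homogeneous_degree_def using keys_add[of p q] by blast

lemma homogeneous_degree_mult:
  assumes "homogeneous_degree d p" "homogeneous_degree e q"
  shows "homogeneous_degree (d + e) (p * q)"
  unfolding homogeneous_degree_def
proof
  fix m assume "m \<in> Poly_Mapping.keys (p * q)"
  then obtain k l where "m = k + l" "k \<in> Poly_Mapping.keys p" "l \<in> Poly_Mapping.keys q"
    using keys_mult[of p q] by blast
  then show "(\<Sum>i\<in>UNIV. Poly_Mapping.lookup m i) = d + e"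
    using assms by (simp add: homogeneous_degree_def lookup_add sum.distrib)
qed

lemma homogeneous_degree_Const: "homogeneous_degree 0 (Const s)"
  by (simp add: homogeneous_degree_def Const_def)

lemma homogeneous_degree_Var: "homogeneous_degree 1 (Var i)"
  by (simp add: homogeneous_degree_def Var_def lookup_single when_def)

lemma homogeneous_degree_sum:
  "(\<And>x. x \<in> A \<Longrightarrow> homogeneous_degree d (g x)) \<Longrightarrow> homogeneous_degree d (sum g A)"
  by (induction A rule: infinite_finite_induct)
    (auto intro: homogeneous_degree_add simp: homogeneous_degree_def[of _ 0])

lemma homogeneous_degree_prod_Var: "finite A \<Longrightarrow> homogeneous_degree (card A) (\<Prod>i\<in>A. Var i)"
proof (induction A rule: finite_induct)
  case empty
  then show ?case using homogeneous_degree_Const[of 1] by (simp add: Const_def)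
next
  case (insert i A)
  then show ?case using homogeneous_degree_mult[OF homogeneous_degree_Var[of i] insert.IH] by simp
qed

lemma homogeneous_degree_norm_elem_sym: "homogeneous_degree k (norm_elem_sym k)"
proof -
  have "homogeneous_degree k (elem_sym k)"
    unfolding elem_sym_def
    by (rule homogeneous_degree_sum) (use homogeneous_degree_prod_Var finite in force)
  from homogeneous_degree_mult[OF homogeneous_degree_Const this]
  show ?thesis by (simp add: norm_elem_sym_def)
qed

section \<open>Elementary symmetric functions and power sums\<close>

text \<open>Sort the subsets by whether they contain i; those that do are \<open>insert i S\<close>
  for a unique k-subset S of A. This is the recursion of elementary symmetric functions when one
  variable is added.\<close>

lemma sum_subsets_card_insert:
  fixes y :: "'i \<Rightarrow> 'a::comm_semiring_1"
  assumes "finite A" "i \<notin> A"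
  shows "(\<Sum>S | S \<subseteq> insert i A \<and> card S = Suc k. \<Prod>j\<in>S. y j) =
    (\<Sum>S | S \<subseteq> A \<and> card S = Suc k. \<Prod>j\<in>S. y j) +
    y i * (\<Sum>S | S \<subseteq> A \<and> card S = k. \<Prod>j\<in>S. y j)"
proof -
  let ?T = "{S. S \<subseteq> A \<and> card S = k}"
  have split: "{S. S \<subseteq> insert i A \<and> card S = Suc k} =
      {S. S \<subseteq> A \<and> card S = Suc k} \<union> insert i ` ?T" (is "?L = ?R")
  proof
    show "?L \<subseteq> ?R"
    proof
      fix S assume S: "S \<in> ?L"
      show "S \<in> ?R"
      proof (cases "i \<in> S")
        case True
        then have "S = insert i (S - {i})" "S - {i} \<in> ?T"
          using S by (auto simp: finite_subset[of S "insert i A"] assms)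
        then show ?thesis by blast
      qed (use S in auto)
    qed
    have "card (insert i S) = Suc (card S)" if "S \<subseteq> A" for S
      using that assms by (meson card_insert_disjoint finite_subset subsetD)
    then show "?R \<subseteq> ?L" by auto
  qed
  have inj: "inj_on (insert i) ?T"
    using assms(2) by (intro inj_onI) (metis (mono_tags) Diff_insert_absorb mem_Collect_eq subsetD)
  have "(\<Sum>S\<in>insert i ` ?T. \<Prod>j\<in>S. y j) = (\<Sum>S\<in>?T. y i * (\<Prod>j\<in>S. y j))"
    using assms by (subst sum.reindex[OF inj])
      (auto intro!: sum.cong prod.insert dest: finite_subset)
  then show ?thesis
    unfolding split
    using assms by (subst sum.union_disjoint) (auto simp: sum_distrib_left)
qed

text \<open>Induction on the set of variables: the recursion above gives the increment of each E,
  and a new variable adds its power to each P. The factors 2 and 6 avoid division, so any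
  commutative ring will do.\<close>

lemma newton_identities:
  fixes y :: "'i \<Rightarrow> 'a::comm_ring_1"
  assumes "finite A"
  defines "E \<equiv> \<lambda>k. \<Sum>S | S \<subseteq> A \<and> card S = k. \<Prod>j\<in>S. y j"
    and "P \<equiv> \<lambda>k. \<Sum>j\<in>A. y j ^ k"
  shows "E 1 = P 1"
    and "2 * E 2 = P 1 ^ 2 - P 2"
    and "6 * E 3 = P 1 ^ 3 - 3 * P 1 * P 2 + 2 * P 3"
proof -
  have "E 1 = P 1 \<and> 2 * E 2 = P 1 ^ 2 - P 2 \<and> 6 * E 3 = P 1 ^ 3 - 3 * P 1 * P 2 + 2 * P 3"
    using assms(1) unfolding E_def P_def
  proof (induction A rule: finite_induct)
    case empty
    have none: "(\<Sum>S | S \<subseteq> {} \<and> card S = k. \<Prod>j\<in>S. y j) = 0" if "0 < k" for k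
      by (rule sum.neutral) (use that in auto)
    show ?case
      unfolding none[OF zero_less_one] none[OF zero_less_numeral] by simp
  next
    case (insert i A)
    define E where "E k = (\<Sum>S | S \<subseteq> A \<and> card S = k. \<Prod>j\<in>S. y j)" for k
    define P where "P k = (\<Sum>j\<in>A. y j ^ k)" for k
    \<comment> \<open>Infinite sets also have \<open>card\<close> 0; finiteness of A leaves only the
      empty set.\<close>
    have "{S. S \<subseteq> A \<and> card S = 0} = {{}}"
      using insert.hyps(1) by (auto dest: finite_subset)
    then have E0: "E 0 = 1" by (simp add: E_def)
    have IH: "E 1 = P 1" "2 * E 2 = P 1 ^ 2 - P 2" "6 * E 3 = P 1 ^ 3 - 3 * P 1 * P 2 + 2 * P 3"
      using insert.IH by (simp_all only: E_def P_def)
    have Einsert: "(\<Sum>S | S \<subseteq> insert i A \<and> card S = Suc k. \<Prod>j\<in>S. y j) = E (Suc k) + y i * E k" for k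
      using sum_subsets_card_insert[OF insert.hyps] by (simp only: E_def)
    have Pinsert: "(\<Sum>j\<in>insert i A. y j ^ k) = y i ^ k + P k" for k
      using insert.hyps by (simp add: P_def)
    have e: "E 1 + y i * 1 = y i ^ 1 + P 1" using IH by simp
    have "2 * (E 2 + y i * E 1) = (y i ^ 1 + P 1) ^ 2 - (y i ^ 2 + P 2)"
      unfolding distrib_left[of 2] IH by (simp add: power2_eq_square algebra_simps)
    moreover have "6 * (E 3 + y i * E 2) =
        (y i ^ 1 + P 1) ^ 3 - 3 * (y i ^ 1 + P 1) * (y i ^ 2 + P 2) + 2 * (y i ^ 3 + P 3)"
    proof -
      \<comment> \<open>Regrouped so that only the multiples 6 E 3 and 2 E 2, known by induction,
        occur.\<close>
      have "6 * (E 3 + y i * E 2) = 6 * E 3 + 3 * y i * (2 * E 2)" by (simp add: algebra_simps)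
      then show ?thesis
        unfolding IH by (simp add: power2_eq_square power3_eq_cube algebra_simps)
    qed
    moreover have "(\<Sum>S | S \<subseteq> insert i A \<and> card S = 1. \<Prod>j\<in>S. y j) = E 1 + y i * 1"
      "(\<Sum>S | S \<subseteq> insert i A \<and> card S = 2. \<Prod>j\<in>S. y j) = E 2 + y i * E 1"
      "(\<Sum>S | S \<subseteq> insert i A \<and> card S = 3. \<Prod>j\<in>S. y j) = E 3 + y i * E 2"
      using Einsert[of 0] Einsert[of 1] Einsert[of 2] E0
      by (simp_all add: numeral_2_eq_2 numeral_3_eq_3)
    ultimately show ?case
      using e by (simp only: Pinsert)
  qed
  then show "E 1 = P 1" "2 * E 2 = P 1 ^ 2 - P 2" "6 * E 3 = P 1 ^ 3 - 3 * P 1 * P 2 + 2 * P 3"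
    by simp_all
qed

section \<open>Depressed real cubics\<close>

text \<open>The quantity 4 p^3 + 27 q^2 is minus the discriminant. Both directions write it as a
  square times a factor whose sign tells whether two of the roots are non-real.\<close>

lemma depressed_cubic_real_rooted_iff:
  fixes p q :: real
  shows "(\<forall>w::complex. w ^ 3 + of_real p * w + of_real q = 0 \<longrightarrow> w \<in> \<real>) \<longleftrightarrow>
    4 * p ^ 3 + 27 * q ^ 2 \<le> 0"
proof
  assume real: "\<forall>w::complex. w ^ 3 + of_real p * w + of_real q = 0 \<longrightarrow> w \<in> \<real>"
  obtain r :: real where r: "r ^ 3 + p * r + q = 0"
  proof -
    \<comment> \<open>M is large enough for the cube to dominate p r + q at r = M and r = -M, which
      gives a sign change on [-M, M].\<close>
    define M where "M = 1 + \<bar>p\<bar> + \<bar>q\<bar>"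
    have M: "M \<ge> 1" "\<bar>p\<bar> + \<bar>q\<bar> \<le> M - 1" by (simp_all add: M_def)
    have "\<bar>p * M + q\<bar> \<le> \<bar>p\<bar> * M + \<bar>q\<bar> * M"
      using M mult_left_mono[of 1 M "\<bar>q\<bar>"]
      by (intro order_trans[OF abs_triangle_ineq]) (simp add: abs_mult)
    also have "\<dots> \<le> (M - 1) * M"
      using M by (metis distrib_right mult_right_mono order_trans zero_le_one)
    also have "\<dots> \<le> M ^ 2" using M by (simp add: power2_eq_square algebra_simps)
    also have "\<dots> \<le> M ^ 3" using M by (intro power_increasing) auto
    finally have b1: "\<bar>p * M + q\<bar> \<le> M ^ 3" .
    have "\<bar>p * M - q\<bar> \<le> \<bar>p\<bar> * M + \<bar>q\<bar> * M"
      using M mult_left_mono[of 1 M "\<bar>q\<bar>"]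
      by (intro order_trans[OF abs_triangle_ineq4]) (simp add: abs_mult)
    also have "\<dots> \<le> (M - 1) * M"
      using M by (metis distrib_right mult_right_mono order_trans zero_le_one)
    also have "\<dots> \<le> M ^ 2" using M by (simp add: power2_eq_square algebra_simps)
    also have "\<dots> \<le> M ^ 3" using M by (intro power_increasing) auto
    finally have b2: "\<bar>p * M - q\<bar> \<le> M ^ 3" .
    have "\<exists>r. - M \<le> r \<and> r \<le> M \<and> r ^ 3 + p * r + q = 0"
      using b1 b2 M(1) by (intro IVT') (auto intro!: continuous_intros simp: power3_eq_cube)
    then show ?thesis using that by blast
  qed
  \<comment> \<open>Dividing the cubic by w - r leaves w^2 + r w + (r^2 + p), with discriminant -D.
    If D were positive, this factor would have a non-real root.\<close>
  define D where "D = 3 * r ^ 2 + 4 * p"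
  have q: "q = - (r ^ 3) - p * r" using r by simp
  have "D \<le> 0"
  proof (rule ccontr)
    assume "\<not> D \<le> 0"
    define w where "w = Complex (- r / 2) (sqrt D / 2)"
    have "(w + of_real r / 2) ^ 2 = - of_real D / 4"
      using \<open>\<not> D \<le> 0\<close> by (auto simp: w_def complex_eq_iff power2_eq_square)
    moreover have "w ^ 2 + of_real r * w + of_real (r ^ 2 + p) =
        (w + of_real r / 2) ^ 2 + of_real D / 4"
      by (simp add: D_def power2_eq_square field_simps)
    ultimately have "w ^ 2 + of_real r * w + of_real (r ^ 2 + p) = 0"
      by simp
    moreover have "w ^ 3 + of_real p * w + of_real q =
        (w - of_real r) * (w ^ 2 + of_real r * w + of_real (r ^ 2 + p))"
      by (simp add: q power2_eq_square power3_eq_cube algebra_simps)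
    ultimately have "w \<in> \<real>" using real by simp
    then show False using \<open>\<not> D \<le> 0\<close> by (simp add: w_def complex_is_Real_iff)
  qed
  \<comment> \<open>The squared factor p + 3 r^2 is the derivative of the cubic at r.\<close>
  moreover have "4 * p ^ 3 + 27 * q ^ 2 = D * (p + 3 * r ^ 2) ^ 2"
    unfolding q D_def by algebra
  ultimately show "4 * p ^ 3 + 27 * q ^ 2 \<le> 0"
    by (simp add: mult_nonpos_nonneg)
next
  assume disc: "4 * p ^ 3 + 27 * q ^ 2 \<le> 0"
  show "\<forall>w::complex. w ^ 3 + of_real p * w + of_real q = 0 \<longrightarrow> w \<in> \<real>"
  proof (intro allI impI)
    fix w :: complex assume w: "w ^ 3 + of_real p * w + of_real q = 0"
    obtain s t where st: "w = Complex s t" by (cases w)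
    have re: "s ^ 3 - 3 * s * t ^ 2 + p * s + q = 0"
      and im: "t * (3 * s ^ 2 - t ^ 2 + p) = 0"
      using w unfolding st
      by (auto simp: complex_eq_iff power2_eq_square power3_eq_cube algebra_simps)
    have "t = 0"
    proof (rule ccontr)
      assume "t \<noteq> 0"
      then have t2: "t ^ 2 = 3 * s ^ 2 + p" using im by simp
      have q: "q = 8 * s ^ 3 + 2 * p * s"
        using re unfolding t2 by (simp add: power2_eq_square power3_eq_cube algebra_simps)
      \<comment> \<open>The roots sum to zero, so the third one is -2 s. This is the factorization
        of the first direction at r = -2 s, where D becomes 4 (p + 3 s^2) = 4 t^2.\<close>
      have "4 * p ^ 3 + 27 * q ^ 2 = 4 * (p + 3 * s ^ 2) * (p + 12 * s ^ 2) ^ 2"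
        unfolding q by algebra
      moreover have pos: "p + 3 * s ^ 2 > 0"
        using t2 \<open>t \<noteq> 0\<close> by (metis add.commute zero_less_power2)
      moreover have "p + 12 * s ^ 2 > 0" using pos by (smt (verit) zero_le_power2)
      ultimately have "4 * p ^ 3 + 27 * q ^ 2 > 0" by simp
      then show False using disc by simp
    qed
    then show "w \<in> \<real>" by (simp add: st complex_is_Real_iff)
  qed
qed

section \<open>The extremal third power sum\<close>

text \<open>Cauchy-Schwarz applied to the other n - 1 entries, whose sum is -x_i. The scaling of r
  gives r = 1 for (n - 1, -1, ..., -1).\<close>

lemma le_of_sum_zero_sum_squares:
  fixes x :: "'i \<Rightarrow> real"
  assumes A: "finite A" "i \<in> A" and sum0: "(\<Sum>j\<in>A. x j) = 0"
    and r: "r \<ge> 0" "(\<Sum>j\<in>A. x j ^ 2) = real (card A) * (real (card A) - 1) * r ^ 2"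
  shows "x i \<le> (real (card A) - 1) * r"
proof -
  define n where "n = real (card A)"
  have n1: "n \<ge> 1" using A by (auto simp: n_def Suc_le_eq card_gt_0_iff)
  have c: "real (card (A - {i})) = n - 1"
    using A n1 by (simp add: n_def card_Diff_singleton of_nat_diff)
  have "(\<Sum>j\<in>A - {i}. x j) = - x i" "(\<Sum>j\<in>A - {i}. x j ^ 2) = n * (n - 1) * r ^ 2 - x i ^ 2"
    using sum.remove[OF A, of x] sum.remove[OF A, of "\<lambda>j. x j ^ 2"] sum0 r by (simp_all add: n_def)
  moreover have "(\<Sum>j\<in>A - {i}. x j) ^ 2 \<le> (\<Sum>j\<in>A - {i}. x j ^ 2) * real (card (A - {i}))"
    by (rule sum_squared_le_sum_of_squares)
  ultimately have "x i ^ 2 \<le> (n * (n - 1) * r ^ 2 - x i ^ 2) * (n - 1)"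
    by (simp add: c)
  then have "n * x i ^ 2 \<le> n * ((n - 1) * r) ^ 2"
    by (simp add: power2_eq_square algebra_simps)
  then have "x i ^ 2 \<le> ((n - 1) * r) ^ 2" using n1 by simp
  moreover have "0 \<le> (n - 1) * r" using n1 r(1) by simp
  ultimately show ?thesis unfolding n_def[symmetric] by (rule power2_le_imp_le)
qed

text \<open>By the preceding bound every entry lies where the cubic (t - (n - 1) r) (t + r)^2 is
  nonpositive. After summation the constraints fix all terms of lower degree, leaving a bound on the
  cubes alone.\<close>

lemma sum_cubes_le:
  fixes x :: "'i \<Rightarrow> real"
  assumes A: "finite A" and sum0: "(\<Sum>j\<in>A. x j) = 0"
    and r: "r \<ge> 0" "(\<Sum>j\<in>A. x j ^ 2) = real (card A) * (real (card A) - 1) * r ^ 2"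
  shows "(\<Sum>j\<in>A. x j ^ 3) \<le> real (card A) * (real (card A) - 1) * (real (card A) - 2) * r ^ 3"
proof -
  define n where "n = real (card A)"
  \<comment> \<open>Equality holds at multiples of \<open>(n - 1, -1, \<dots>, -1)\<close>, where every summand vanishes.\<close>
  have "(\<Sum>j\<in>A. (x j - (n - 1) * r) * (x j + r) ^ 2) \<le> 0"
    using le_of_sum_zero_sum_squares[OF A _ sum0 r] by (intro sum_nonpos) (simp add: n_def mult_nonpos_nonneg)
  also have "(\<Sum>j\<in>A. (x j - (n - 1) * r) * (x j + r) ^ 2) =
      (\<Sum>j\<in>A. x j ^ 3 + (3 - n) * r * x j ^ 2 + (3 - 2 * n) * r ^ 2 * x j - (n - 1) * r ^ 3)"
    by (rule sum.cong) (simp_all add: power2_eq_square power3_eq_cube algebra_simps)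
  also have "\<dots> = (\<Sum>j\<in>A. x j ^ 3) + (3 - n) * r * (n * (n - 1) * r ^ 2) - n * ((n - 1) * r ^ 3)"
    by (simp add: sum.distrib sum_subtractf sum0 r n_def flip: sum_distrib_left)
  finally show ?thesis
    by (simp add: n_def[symmetric] power2_eq_square power3_eq_cube algebra_simps)
qed

section \<open>Restriction to lines in the direction of the all-ones vector\<close>

lemma of_nat_choose_two_three:
  fixes n :: nat
  shows "real (n choose 2) = real n * (real n - 1) / 2"
    and "real (n choose 3) = real n * (real n - 1) * (real n - 2) / 6"
  by (simp_all add: binomial_gbinomial gbinomial_prod_rev numeral_2_eq_2 numeral_3_eq_3 fact_Suc)

interpretation of_real: coeff_hom complex_of_real
  by unfold_locales simp_all

text \<open>Expand the power sums of y_i + w, pass to elementary symmetric functions by Newton's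
  identities, and divide by the binomial coefficients. The scaling of u and v, including the factor
  2, makes -u and v the normalized values at y and removes n from the results.\<close>

lemma subst_norm_elem_sym_centered:
  fixes y :: "'n::finite \<Rightarrow> real" and w :: complex and u v :: real
  defines "n \<equiv> real CARD('n)"
  assumes n: "CARD('n) \<ge> 3"
    and y: "(\<Sum>i\<in>UNIV. y i) = 0" "(\<Sum>i\<in>UNIV. y i ^ 2) = n * (n - 1) * u"
      "2 * (\<Sum>i\<in>UNIV. y i ^ 3) = n * (n - 1) * (n - 2) * v"
  defines "subst \<equiv> subst_mpoly complex_of_real (\<lambda>i. complex_of_real (y i) + w)"
  shows "subst (norm_elem_sym 1) = w"
    and "subst (norm_elem_sym 2) = w ^ 2 - of_real u"
    and "subst (norm_elem_sym 3) = w ^ 3 - 3 * of_real u * w + of_real v"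
proof -
  define N where "N = complex_of_real n"
  define f where "f i = complex_of_real (y i) + w" for i
  define E where "E k = (\<Sum>S | S \<subseteq> (UNIV :: 'n set) \<and> card S = k. \<Prod>j\<in>S. f j)" for k
  define P where "P k = (\<Sum>j\<in>UNIV. f j ^ k)" for k
  \<comment> \<open>With n at least 3 all three normalizing binomial coefficients are
    nonzero.\<close>
  have "n \<noteq> 0" "n - 1 \<noteq> 0" "n - 2 \<noteq> 0"
    using n by (auto simp: n_def)
  from this[folded of_real_eq_0_iff[where 'a = complex]]
  have N: "N \<noteq> 0" "N - 1 \<noteq> 0" "N - 2 \<noteq> 0"
    by (simp_all add: N_def)
  have subst: "subst (norm_elem_sym k) = of_real (inverse (real (CARD('n) choose k))) * E k" for k
    by (simp add: subst_def norm_elem_sym_def of_real.subst_mpoly_mult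
        of_real.subst_mpoly_elem_sym E_def f_def)
  have cy: "(\<Sum>i\<in>UNIV. complex_of_real (y i)) = 0"
    "(\<Sum>i\<in>UNIV. complex_of_real (y i) ^ 2) = N * (N - 1) * of_real u"
    "2 * (\<Sum>i\<in>UNIV. complex_of_real (y i) ^ 3) = N * (N - 1) * (N - 2) * of_real v"
    using y[THEN arg_cong[where f = complex_of_real]] by (simp_all add: N_def)
  have card: "of_nat CARD('n) = N" by (simp add: N_def n_def)
  have P1: "P 1 = N * w"
    by (simp add: P_def f_def sum.distrib cy card)
  have "P 2 = (\<Sum>i\<in>UNIV. complex_of_real (y i) ^ 2 + 2 * w * complex_of_real (y i) + w ^ 2)"
    unfolding P_def f_def by (rule sum.cong) (simp_all add: power2_eq_square algebra_simps)
  then have P2: "P 2 = N * (N - 1) * of_real u + N * w ^ 2"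
    by (simp add: sum.distrib cy card flip: sum_distrib_left)
  have "P 3 = (\<Sum>i\<in>UNIV. complex_of_real (y i) ^ 3 + 3 * w * complex_of_real (y i) ^ 2
      + 3 * w ^ 2 * complex_of_real (y i) + w ^ 3)"
    unfolding P_def f_def
    by (rule sum.cong) (simp_all add: power2_eq_square power3_eq_cube algebra_simps)
  then have "2 * P 3 = 2 * (\<Sum>i\<in>UNIV. complex_of_real (y i) ^ 3)
      + 6 * w * (N * (N - 1) * of_real u) + 2 * N * w ^ 3"
    by (simp add: sum.distrib cy card distrib_left flip: sum_distrib_left)
  then have P3: "2 * P 3 = N * (N - 1) * (N - 2) * of_real v
      + 6 * w * (N * (N - 1) * of_real u) + 2 * N * w ^ 3"
    by (simp only: cy)
  note newton = newton_identities[of "UNIV :: 'n set" f, folded E_def P_def, OF finite]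
  show "subst (norm_elem_sym 1) = w"
    using N unfolding subst newton(1) P1 by (simp add: N_def n_def)
  have "2 * E 2 = N * (N - 1) * (w ^ 2 - of_real u)"
    unfolding newton P1 P2 by algebra
  moreover have "subst (norm_elem_sym 2) = 2 * E 2 / (N * (N - 1))"
    unfolding subst of_nat_choose_two_three n_def[symmetric] N_def by simp
  ultimately show "subst (norm_elem_sym 2) = w ^ 2 - of_real u"
    using N by simp
  have "6 * E 3 = N * (N - 1) * (N - 2) * (w ^ 3 - 3 * of_real u * w + of_real v)"
    unfolding newton P1 P2 P3 by algebra
  moreover have "subst (norm_elem_sym 3) = 6 * E 3 / (N * (N - 1) * (N - 2))"
    unfolding subst of_nat_choose_two_three n_def[symmetric] N_def by simp
  ultimately show "subst (norm_elem_sym 3) = w ^ 3 - 3 * of_real u * w + of_real v"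
    using N by simp
qed

definition sym_cubic :: "real \<Rightarrow> real \<Rightarrow> real \<Rightarrow> ('n::finite) real_mpoly" where
  "sym_cubic a b c = Const a * norm_elem_sym 1 ^ 3
     + Const b * norm_elem_sym 1 * norm_elem_sym 2 + Const c * norm_elem_sym 3"

lemma homogeneous_sym_cubic: "homogeneous_mpoly (sym_cubic a b c)"
proof -
  note h = homogeneous_degree_mult homogeneous_degree_Const homogeneous_degree_norm_elem_sym
  \<comment> \<open>Degrees and products are bracketed exactly as
    \<open>homogeneous_degree_mult\<close> produces them.\<close>
  have "homogeneous_degree (0 + (1 + (1 + 1))) (Const a * (norm_elem_sym 1 * (norm_elem_sym 1 * norm_elem_sym 1)))"
    "homogeneous_degree (0 + 1 + 2) (Const b * norm_elem_sym 1 * norm_elem_sym 2)"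
    "homogeneous_degree (0 + 3) (Const c * norm_elem_sym 3)"
    by (intro h)+
  then have "homogeneous_degree 3 (sym_cubic a b c)"
    unfolding sym_cubic_def by (intro homogeneous_degree_add) (simp_all add: power3_eq_cube mult.assoc numeral_3_eq_3)
  then show ?thesis by (auto simp: homogeneous_mpoly_def homogeneous_degree_def)
qed

text \<open>Collects a w^3 + b w (w^2 - u) + c (w^3 - 3 u w + v) by powers of w. Centering y has
  removed the quadratic term.\<close>

lemma subst_sym_cubic_centered:
  fixes y :: "'n::finite \<Rightarrow> real" and w :: complex and u v :: real
  assumes "CARD('n) \<ge> 3"
    and "(\<Sum>i\<in>UNIV. y i) = 0"
    and "(\<Sum>i\<in>UNIV. y i ^ 2) = real CARD('n) * (real CARD('n) - 1) * u"
    and "2 * (\<Sum>i\<in>UNIV. y i ^ 3) = real CARD('n) * (real CARD('n) - 1) * (real CARD('n) - 2) * v"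
  shows "subst_mpoly complex_of_real (\<lambda>i. complex_of_real (y i) + w) (sym_cubic a b c) =
    of_real (a + b + c) * w ^ 3 - of_real ((b + 3 * c) * u) * w + of_real (c * v)"
  unfolding sym_cubic_def of_real.subst_mpoly_add of_real.subst_mpoly_mult
    of_real.subst_mpoly_power of_real.subst_mpoly_Const subst_norm_elem_sym_centered[OF assms]
  by (simp add: power2_eq_square power3_eq_cube algebra_simps)

lemma eval_sym_cubic_ones:
  assumes "CARD('n::finite) \<ge> 3"
  shows "eval_mpoly (sym_cubic a b c) ((\<chi> i. 1) :: real ^ 'n) = a + b + c"
proof -
  have "complex_of_real (eval_mpoly (sym_cubic a b c) ((\<chi> i. 1) :: real ^ 'n)) =
      subst_mpoly complex_of_real (\<lambda>i. complex_of_real 0 + 1) (sym_cubic a b c :: 'n real_mpoly)"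
    by (simp add: eval_mpoly_def subst_mpoly_def)
  \<comment> \<open>The all-ones vector is the centered point y = 0 shifted by w = 1, so u = v =
    0.\<close>
  also have "\<dots> = of_real (a + b + c)"
    using subst_sym_cubic_centered[OF assms, of "\<lambda>_. 0" 0 0 1 a b c] by simp
  finally show ?thesis by (simp only: of_real_eq_iff)
qed

text \<open>The hypotheses force m to be the mean of the entries. With w = z + m the restriction is
  a multiple of a depressed cubic, and its discriminant gives the condition.\<close>

lemma only_real_roots_restrict_sym_cubic_iff:
  fixes x :: "real ^ 'n::finite" and m u v :: real
  assumes n: "CARD('n) \<ge> 3" and A: "a + b + c \<noteq> 0"
    and y: "(\<Sum>i\<in>UNIV. x $ i - m) = 0"
      "(\<Sum>i\<in>UNIV. (x $ i - m) ^ 2) = real CARD('n) * (real CARD('n) - 1) * u"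
      "2 * (\<Sum>i\<in>UNIV. (x $ i - m) ^ 3) = real CARD('n) * (real CARD('n) - 1) * (real CARD('n) - 2) * v"
  shows "only_real_roots (restrict_line (sym_cubic a b c) x (\<chi> i. 1)) \<longleftrightarrow>
    27 * ((a + b + c) * c) ^ 2 * v ^ 2 \<le> 4 * ((a + b + c) * (b + 3 * c) ^ 3) * u ^ 3"
proof -
  define A where "A = a + b + c"
  define B where "B = b + 3 * c"
  define p where "p = - (B * u) / A"
  define q where "q = c * v / A"
  have "A \<noteq> 0" using assms by (simp add: A_def)
  have factor: "of_real A * w ^ 3 - of_real (B * u) * w + of_real (c * v) =
      of_real A * (w ^ 3 + of_real p * w + of_real q)" for w :: complex
    using \<open>A \<noteq> 0\<close> by (simp add: p_def q_def field_simps)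
  have root: "poly (map_poly complex_of_real (restrict_line (sym_cubic a b c) x (\<chi> i. 1))) z =
      of_real A * ((z + of_real m) ^ 3 + of_real p * (z + of_real m) + of_real q)" for z
  proof -
    have "poly (map_poly complex_of_real (restrict_line (sym_cubic a b c) x (\<chi> i. 1))) z =
        subst_mpoly complex_of_real (\<lambda>i. complex_of_real (x $ i - m) + (z + of_real m)) (sym_cubic a b c)"
      by (simp add: poly_restrict_line)
    also have "\<dots> = of_real A * (z + of_real m) ^ 3 - of_real (B * u) * (z + of_real m) + of_real (c * v)"
      unfolding A_def B_def by (rule subst_sym_cubic_centered[OF n y])
    also have "\<dots> = of_real A * ((z + of_real m) ^ 3 + of_real p * (z + of_real m) + of_real q)"
      by (rule factor)
    finally show ?thesis .
  qed
  have "only_real_roots (restrict_line (sym_cubic a b c) x (\<chi> i. 1)) \<longleftrightarrow>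
      (\<forall>z::complex. (z + of_real m) ^ 3 + of_real p * (z + of_real m) + of_real q = 0 \<longrightarrow> z \<in> \<real>)"
    using \<open>A \<noteq> 0\<close> unfolding only_real_roots_def root
    by (simp only: mult_eq_0_iff of_real_eq_0_iff simp_thms)
  \<comment> \<open>A real translation of the variable preserves reality of roots.\<close>
  also have "\<dots> \<longleftrightarrow> (\<forall>w::complex. w ^ 3 + of_real p * w + of_real q = 0 \<longrightarrow> w \<in> \<real>)"
    (is "?L \<longleftrightarrow> ?R")
  proof
    assume L: ?L
    show ?R
    proof (intro allI impI)
      fix w :: complex assume "w ^ 3 + of_real p * w + of_real q = 0"
      then have "w - of_real m \<in> \<real>" using L[rule_format, of "w - of_real m"] by simp
      then show "w \<in> \<real>" using Reals_add[of "w - of_real m" "of_real m"] by simp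
    qed
  next
    assume R: ?R
    show ?L
    proof (intro allI impI)
      fix z :: complex assume "(z + of_real m) ^ 3 + of_real p * (z + of_real m) + of_real q = 0"
      then have "z + of_real m \<in> \<real>" using R by blast
      then show "z \<in> \<real>" using Reals_diff[of "z + of_real m" "of_real m"] by simp
    qed
  qed
  also have "\<dots> \<longleftrightarrow> 4 * p ^ 3 + 27 * q ^ 2 \<le> 0"
    by (rule depressed_cubic_real_rooted_iff)
  \<comment> \<open>An even power of A clears the denominators of p^3 and q^2 while keeping the
    direction of the inequality for either sign of A.\<close>
  also have "\<dots> \<longleftrightarrow> A ^ 4 * (4 * p ^ 3 + 27 * q ^ 2) \<le> 0"
    using \<open>A \<noteq> 0\<close> by (simp add: mult_le_0_iff)
  also have "A ^ 4 * (4 * p ^ 3 + 27 * q ^ 2) = 4 * A * (A * p) ^ 3 + 27 * A ^ 2 * (A * q) ^ 2"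
    by algebra
  also have "A * p = - (B * u)" using \<open>A \<noteq> 0\<close> by (simp add: p_def)
  also have "A * q = c * v" using \<open>A \<noteq> 0\<close> by (simp add: q_def)
  also have "4 * A * (- (B * u)) ^ 3 + 27 * A ^ 2 * (c * v) ^ 2 =
      27 * (A * c) ^ 2 * v ^ 2 - 4 * (A * B ^ 3) * u ^ 3"
    by algebra
  finally show ?thesis by (simp add: A_def B_def)
qed

text \<open>The condition on a line depends only on u and v. The extremal vector has v^2 = 4 u^3,
  where it becomes the stated inequality; elsewhere v^2 is at most 4 u^3, and the inequality
  suffices.\<close>

lemma only_real_roots_sym_cubic_all_iff:
  fixes a b c :: real
  assumes n: "CARD('n::finite) \<ge> 3" and A: "a + b + c \<noteq> 0"
  shows "(\<forall>x :: real ^ 'n. only_real_roots (restrict_line (sym_cubic a b c) x (\<chi> i. 1))) \<longleftrightarrow>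
    27 * ((a + b + c) * c) ^ 2 \<le> (a + b + c) * (b + 3 * c) ^ 3"
proof
  define n where "n = real CARD('n)"
  \<comment> \<open>Any coordinate may carry the large entry of the extremal vector (n - 1, -1, ...,
    -1), which has m = 0, u = 1 and v = 2.\<close>
  obtain k :: 'n where True by simp
  define x :: "real ^ 'n" where "x = (\<chi> i. if i = k then n - 1 else - 1)"
  have pow: "(\<Sum>i\<in>UNIV. (x $ i) ^ d) = (n - 1) ^ d + (n - 1) * (- 1) ^ d" for d
  proof -
    have "(\<Sum>i\<in>UNIV. (x $ i) ^ d) = (n - 1) ^ d + (\<Sum>i\<in>UNIV - {k}. (x $ i) ^ d)"
      by (subst sum.remove[of _ k]) (simp_all add: x_def)
    also have "(\<Sum>i\<in>UNIV - {k}. (x $ i) ^ d) = (\<Sum>i\<in>UNIV - {k}. (- 1) ^ d)"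
      by (rule sum.cong) (simp_all add: x_def)
    also have "\<dots> = (n - 1) * (- 1) ^ d"
      using assms(1) by (simp add: n_def card_Diff_singleton of_nat_diff)
    finally show ?thesis .
  qed
  have "(\<Sum>i\<in>UNIV. x $ i - 0) = 0"
    using pow[of 1] by simp
  moreover have "(\<Sum>i\<in>UNIV. (x $ i - 0) ^ 2) = n * (n - 1) * 1"
    using pow[of 2] by (simp add: power2_eq_square algebra_simps)
  moreover have "2 * (\<Sum>i\<in>UNIV. (x $ i - 0) ^ 3) = n * (n - 1) * (n - 2) * 2"
    using pow[of 3] by (simp add: power3_eq_cube algebra_simps)
  ultimately have iff: "only_real_roots (restrict_line (sym_cubic a b c) x (\<chi> i. 1)) \<longleftrightarrow>
      27 * ((a + b + c) * c) ^ 2 * 2 ^ 2 \<le> 4 * ((a + b + c) * (b + 3 * c) ^ 3) * 1 ^ 3"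
    unfolding n_def by (rule only_real_roots_restrict_sym_cubic_iff[OF assms])
  assume "\<forall>x :: real ^ 'n. only_real_roots (restrict_line (sym_cubic a b c) x (\<chi> i. 1))"
  with iff show "27 * ((a + b + c) * c) ^ 2 \<le> (a + b + c) * (b + 3 * c) ^ 3"
    by simp
next
  assume le: "27 * ((a + b + c) * c) ^ 2 \<le> (a + b + c) * (b + 3 * c) ^ 3"
  show "\<forall>x :: real ^ 'n. only_real_roots (restrict_line (sym_cubic a b c) x (\<chi> i. 1))"
  proof
    fix x :: "real ^ 'n"
    define n where "n = real CARD('n)"
    define m where "m = (\<Sum>i\<in>UNIV. x $ i) / n"
    define y where "y i = x $ i - m" for i
    define u where "u = (\<Sum>i\<in>UNIV. y i ^ 2) / (n * (n - 1))"
    define v where "v = 2 * (\<Sum>i\<in>UNIV. y i ^ 3) / (n * (n - 1) * (n - 2))"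
    define r where "r = sqrt u"
    have n3: "n \<ge> 3" using assms(1) by (simp add: n_def)
    have "u \<ge> 0" using n3 by (simp add: u_def sum_nonneg)
    then have r: "r \<ge> 0" "r ^ 2 = u" by (simp_all add: r_def)
    have y: "(\<Sum>i\<in>UNIV. y i) = 0" "(\<Sum>i\<in>UNIV. y i ^ 2) = n * (n - 1) * u"
      "2 * (\<Sum>i\<in>UNIV. y i ^ 3) = n * (n - 1) * (n - 2) * v"
      using n3 by (simp_all add: y_def sum_subtractf m_def u_def v_def flip: n_def)
    define K where "K = n * (n - 1) * (n - 2)"
    have "K > 0" using n3 by (simp add: K_def)
    have "(\<Sum>i\<in>UNIV. y i ^ 3) \<le> K * r ^ 3"
      unfolding K_def n_def using y r by (intro sum_cubes_le) (simp_all add: n_def)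
    \<comment> \<open>The bound on cubes is one-sided; applying it to -y as well controls the
      absolute value of v.\<close>
    moreover have "(\<Sum>i\<in>UNIV. (- y i) ^ 3) \<le> K * r ^ 3"
      unfolding K_def n_def using y r by (intro sum_cubes_le) (simp_all add: n_def sum_negf)
    then have "- (\<Sum>i\<in>UNIV. y i ^ 3) \<le> K * r ^ 3"
      by (simp add: sum_negf)
    ultimately have "K * v \<le> K * (2 * r ^ 3)" "K * (- v) \<le> K * (2 * r ^ 3)"
      using y(3)[folded K_def] by simp_all
    then have "\<bar>v\<bar> \<le> 2 * r ^ 3"
      using \<open>K > 0\<close> by (simp only: mult_le_cancel_left_pos abs_le_iff simp_thms)
    then have "v ^ 2 \<le> (2 * r ^ 3) ^ 2"
      using power_mono[of "\<bar>v\<bar>" "2 * r ^ 3" 2] by simp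
    also have "\<dots> = 4 * u ^ 3" unfolding r(2)[symmetric] by algebra
    finally have v: "v ^ 2 \<le> 4 * u ^ 3" .
    have "27 * ((a + b + c) * c) ^ 2 * v ^ 2 \<le> 27 * ((a + b + c) * c) ^ 2 * (4 * u ^ 3)"
      using v by (intro mult_left_mono) simp_all
    also have "\<dots> \<le> (a + b + c) * (b + 3 * c) ^ 3 * (4 * u ^ 3)"
      using le \<open>u \<ge> 0\<close> by (intro mult_right_mono) simp_all
    finally have "27 * ((a + b + c) * c) ^ 2 * v ^ 2 \<le> 4 * ((a + b + c) * (b + 3 * c) ^ 3) * u ^ 3"
      by (simp add: mult_ac)
    then show "only_real_roots (restrict_line (sym_cubic a b c) x (\<chi> i. 1))"
      using only_real_roots_restrict_sym_cubic_iff[OF assms y[unfolded n_def y_def]] by blast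
  qed
qed

theorem corollary1p10:
  fixes a b c :: real
    and p :: "('n::finite) real_mpoly"
  assumes "CARD('n) \<ge> 3"
    and "a + b + c \<noteq> 0"
    and "p = Const a * norm_elem_sym 1 ^ 3
             + Const b * norm_elem_sym 1 * norm_elem_sym 2
             + Const c * norm_elem_sym 3"
  shows "hyperbolic p (\<chi> i. 1) \<longleftrightarrow>
         (a + b + c) * (27 * a * c^2 - b^3 - 9 * b^2 * c) \<le> 0"
proof -
  have p: "p = sym_cubic a b c"
    using assms(3) by (simp only: sym_cubic_def)
  have "hyperbolic p (\<chi> i. 1) \<longleftrightarrow> 27 * ((a + b + c) * c) ^ 2 \<le> (a + b + c) * (b + 3 * c) ^ 3"
    using assms(2) unfolding hyperbolic_def p
    by (simp add: homogeneous_sym_cubic eval_sym_cubic_ones[OF assms(1)]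
        only_real_roots_sym_cubic_all_iff[OF assms(1,2)])
  \<comment> \<open>The terms 27 b c^2 and 27 c^3 of (b + 3 c)^3 cancel against those of 27 (a + b +
    c) c^2.\<close>
  moreover have "(a + b + c) * (27 * a * c^2 - b^3 - 9 * b^2 * c) =
      27 * ((a + b + c) * c) ^ 2 - (a + b + c) * (b + 3 * c) ^ 3"
    by algebra
  ultimately show ?thesis by simp
qed

end
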